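(* Let $k\ge 2$ and let $s,t\ge 1$ be integers. If $s\equiv t \bmod (k-1)$ then the monoids $M_{k,s}$ and $M_{k,t}$ are isomorphic.
   Context: Let $A=\{a_1,\dots,a_k\}$ with $k\ge 2$ and $B=\{b_1,\dots,b_i\}$ with $i\ge 1$ be finite alphabets. $A^*$ is the set of all finite words over $A$ (including the empty word), and $BA^*$ is the set of words $b_jx$ with $b_j\in B$, $x\in A^*$. A right ideal of $BA^*$ is a subset $R\subseteq BA^*$ with $RA^*=R$ (the empty set is allowed). Two sets intersect iff their intersection is non-empty. Two right ideals are essentially equal iff every right ideal of $BA^*$ that intersects one also intersects the other. A right ideal homomorphism over $BA^*$ is a total surjective function $\varphi:R_1\to R_2$ between finitely generated right ideals of $BA^*$ with $\varphi(rx)=\varphi(r)x$ for all $r\in R_1$, $x\in A^*$. Two right ideal homomorphisms are essentially equal iff their domains are essentially equal and they agree on the intersection of their domains. Every right ideal homomorphism $\varphi$ has a unique maximal essentially equal extension to a right ideal homomorphism, denoted $\max(\varphi)$. $M_{k,i}$ (with $|A|=k$, $|B|=i$) is the monoid of all maximally extended right ideal homomorphisms over $BA^*$, with product $\psi\varphi=\max(\psi\circ\varphi)$, where $\circ$ is composition of partial functions ($\varphi$ applied first). *)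

theory Defs
  imports "HOL-Algebra.Group" "HOL-Number_Theory.Cong"
begin

text \<open>Words are lists of letters. The alphabets A and B are finite sets of letters of one type;
  they need not be disjoint, because the decomposition of a word of \<open>BA\<^sup>*\<close> into its first letter
  and the rest is unambiguous in any case.\<close>

definition words :: "'a set \<Rightarrow> 'a set \<Rightarrow> 'a list set" where
  "words A B = {b # x | b x. b \<in> B \<and> x \<in> lists A}"

definition times_star :: "'a set \<Rightarrow> 'a list set \<Rightarrow> 'a list set" where
  "times_star A R = {r @ x | r x. r \<in> R \<and> x \<in> lists A}"

definition right_ideal :: "'a set \<Rightarrow> 'a set \<Rightarrow> 'a list set \<Rightarrow> bool" where
  "right_ideal A B R \<longleftrightarrow> R \<subseteq> words A B \<and> times_star A R = R"

definition fin_gen_right_ideal :: "'a set \<Rightarrow> 'a set \<Rightarrow> 'a list set \<Rightarrow> bool" where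
  "fin_gen_right_ideal A B R \<longleftrightarrow> right_ideal A B R \<and> (\<exists>C. finite C \<and> R = times_star A C)"

definition ess_equal_ideals :: "'a set \<Rightarrow> 'a set \<Rightarrow> 'a list set \<Rightarrow> 'a list set \<Rightarrow> bool" where
  "ess_equal_ideals A B R\<^sub>1 R\<^sub>2 \<longleftrightarrow>
     (\<forall>R. right_ideal A B R \<longrightarrow> (R \<inter> R\<^sub>1 \<noteq> {} \<longleftrightarrow> R \<inter> R\<^sub>2 \<noteq> {}))"

text \<open>A total surjective function \<open>R\<^sub>1 \<rightarrow> R\<^sub>2\<close> is represented by the partial function \<open>\<phi>\<close> on words
  with \<open>dom \<phi> = R\<^sub>1\<close> and \<open>ran \<phi> = R\<^sub>2\<close>.\<close>

definition right_ideal_hom :: "'a set \<Rightarrow> 'a set \<Rightarrow> ('a list \<rightharpoonup> 'a list) \<Rightarrow> bool" where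
  "right_ideal_hom A B \<phi> \<longleftrightarrow>
     fin_gen_right_ideal A B (dom \<phi>) \<and> fin_gen_right_ideal A B (ran \<phi>) \<and>
     (\<forall>r\<in>dom \<phi>. \<forall>x\<in>lists A. \<phi> (r @ x) = Some (the (\<phi> r) @ x))"

definition ess_equal_homs ::
    "'a set \<Rightarrow> 'a set \<Rightarrow> ('a list \<rightharpoonup> 'a list) \<Rightarrow> ('a list \<rightharpoonup> 'a list) \<Rightarrow> bool" where
  "ess_equal_homs A B \<phi> \<psi> \<longleftrightarrow>
     ess_equal_ideals A B (dom \<phi>) (dom \<psi>) \<and> (\<forall>r \<in> dom \<phi> \<inter> dom \<psi>. \<phi> r = \<psi> r)"

definition ess_equal_extension ::
    "'a set \<Rightarrow> 'a set \<Rightarrow> ('a list \<rightharpoonup> 'a list) \<Rightarrow> ('a list \<rightharpoonup> 'a list) \<Rightarrow> bool" where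
  "ess_equal_extension A B \<phi> \<psi> \<longleftrightarrow>
     right_ideal_hom A B \<psi> \<and> ess_equal_homs A B \<phi> \<psi> \<and> \<phi> \<subseteq>\<^sub>m \<psi>"

text \<open>The description is proper whenever \<open>\<phi>\<close> is a right ideal homomorphism: the union of all
  essentially equal extensions of \<open>\<phi>\<close> is again one.\<close>

definition max_extension ::
    "'a set \<Rightarrow> 'a set \<Rightarrow> ('a list \<rightharpoonup> 'a list) \<Rightarrow> ('a list \<rightharpoonup> 'a list)" where
  "max_extension A B \<phi> =
     (THE \<psi>. ess_equal_extension A B \<phi> \<psi> \<and>
        (\<forall>\<chi>. ess_equal_extension A B \<phi> \<chi> \<and> \<psi> \<subseteq>\<^sub>m \<chi> \<longrightarrow> \<chi> = \<psi>))"

text \<open>The monoid \<open>M\<^bsub>k,i\<^esub>\<close> for \<open>k = card A\<close> and \<open>i = card B\<close>. In \<open>\<psi> \<circ>\<^sub>m \<phi>\<close> the map \<open>\<phi>\<close> is applied first;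
  the unit is the identity map of \<open>BA\<^sup>*\<close>.\<close>

definition M_monoid :: "'a set \<Rightarrow> 'a set \<Rightarrow> ('a list \<rightharpoonup> 'a list) monoid" where
  "M_monoid A B =
     \<lparr>carrier = {\<phi>. right_ideal_hom A B \<phi> \<and> max_extension A B \<phi> = \<phi>},
      monoid.mult = (\<lambda>\<psi> \<phi>. max_extension A B (\<psi> \<circ>\<^sub>m \<phi>)),
      one = Some |` words A B\<rparr>"

end

theory Submission
  imports Defs "HOL-Library.Stream"
begin

text \<open>A right ideal homomorphism acts on the set \<open>ends A B\<close> of infinite words \<open>BA\<^sup>\<omega>\<close> by rewriting a
  prefix. Essentially equal homomorphisms induce the same partial map, and \<open>max(\<phi>)\<close> is the largest
  homomorphism inducing the map of \<open>\<phi>\<close>. Hence the monoid is isomorphic to the monoid, under plain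
  composition, of the partial maps on \<open>BA\<^sup>\<omega>\<close> that rewrite prefixes according to a finite table.
  Replacing one letter \<open>b\<close> of \<open>B\<close> by the \<open>k\<close> words \<open>ba\<close> with \<open>a \<in> A\<close> identifies \<open>BA\<^sup>\<omega>\<close> with
  \<open>B'A\<^sup>\<omega>\<close>, where \<open>B'\<close> has \<open>k - 1\<close> more letters, by a bijection that is itself given by a finite
  table, and conjugation by it is an isomorphism of the table monoids.\<close>

section \<open>Partial maps on infinite words\<close>

definition ends :: "'a set \<Rightarrow> 'a set \<Rightarrow> 'a stream set" where
  "ends A B = {b ## w | b w. b \<in> B \<and> w \<in> streams A}"

text \<open>The letters after the rewritten prefix are translated by \<open>\<alpha>\<close>, which allows for maps between
  words over different alphabets. The condition on all long prefixes \<open>u\<close> amounts to a finite table.\<close>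
definition table_map ::
    "('a \<Rightarrow> 'b) \<Rightarrow> 'a set \<Rightarrow> 'a set \<Rightarrow> 'b set \<Rightarrow> 'b set \<Rightarrow> ('a stream \<rightharpoonup> 'b stream) \<Rightarrow> bool" where
  "table_map \<alpha> A B A' B' f \<longleftrightarrow> dom f \<subseteq> ends A B \<and>
     (\<exists>n. \<forall>u\<in>words A B. n \<le> length u \<longrightarrow>
        (\<forall>w\<in>streams A. f (u @- w) = None) \<or>
        (\<exists>v\<in>words A' B'. \<forall>w\<in>streams A. f (u @- w) = Some (v @- smap \<alpha> w)))"

definition table_monoid :: "'a set \<Rightarrow> 'a set \<Rightarrow> ('a stream \<rightharpoonup> 'a stream) monoid" where
  "table_monoid A B =
     \<lparr>carrier = {f. table_map id A B A B f}, monoid.mult = (\<lambda>g f. g \<circ>\<^sub>m f), one = Some |` ends A B\<rparr>"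

section \<open>Prefixes and tails of finite and infinite words\<close>

lemma words_append: "u \<in> words A B \<Longrightarrow> x \<in> lists A \<Longrightarrow> u @ x \<in> words A B"
  by (auto simp: words_def)

lemma words_prefix: "u @ x \<in> words A B \<Longrightarrow> u \<noteq> [] \<Longrightarrow> u \<in> words A B"
  by (cases u) (auto simp: words_def)

lemma words_suffix: "u @ x \<in> words A B \<Longrightarrow> u \<noteq> [] \<Longrightarrow> x \<in> lists A"
  by (cases u) (auto simp: words_def)

lemma Nil_notin_words [simp]: "[] \<notin> words A B"
  by (auto simp: words_def)

lemma finite_words_le:
  assumes "finite A" "finite B" shows "finite {u \<in> words A B. length u \<le> n}"
proof (rule finite_subset)
  show "{u \<in> words A B. length u \<le> n} \<subseteq> {u. set u \<subseteq> A \<union> B \<and> length u \<le> n}"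
    by (auto simp: words_def)
  show "finite {u. set u \<subseteq> A \<union> B \<and> length u \<le> n}"
    using assms by (intro finite_lists_length_le) auto
qed

lemma shift_in_ends: "u \<in> words A B \<Longrightarrow> w \<in> streams A \<Longrightarrow> u @- w \<in> ends A B"
  by (fastforce simp: words_def ends_def intro: shift_streams)

lemma stake_streams: "w \<in> streams A \<Longrightarrow> stake n w \<in> lists A"
  by (induct n arbitrary: w) (auto elim: streamsE)

lemma sdrop_streams: "w \<in> streams A \<Longrightarrow> sdrop n w \<in> streams A"
  by (induct n arbitrary: w) (auto elim: streamsE)

lemma shift_streamsD: "x @- w \<in> streams A \<Longrightarrow> x \<in> lists A \<and> w \<in> streams A"
  by (auto simp: streams_iff_sset)

lemma stake_in_words: "z \<in> ends A B \<Longrightarrow> stake (Suc n) z \<in> words A B"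
proof -
  assume "z \<in> ends A B"
  then obtain b w where "z = b ## w" "b \<in> B" "w \<in> streams A" by (auto simp: ends_def)
  then show ?thesis using stake_streams[of w A n] by (simp add: words_def)
qed

lemma sdrop_in_streams: "z \<in> ends A B \<Longrightarrow> sdrop (Suc n) z \<in> streams A"
  by (auto simp: ends_def dest: sdrop_streams)

lemma ends_split:
  assumes "z \<in> ends A B"
  obtains u w where "z = u @- w" "u \<in> words A B" "w \<in> streams A" "n \<le> length u"
  using that[of "stake (Suc n) z" "sdrop (Suc n) z"] assms stake_in_words sdrop_in_streams
  by (metis le_SucI length_stake order_refl stake_sdrop)

text \<open>Serves to compare two factorisations of one infinite word: its prefixes form a chain, so
  the difference of two of them moves to the front of the longer tail.\<close>

lemma shift_eq_shiftD:
  assumes "u @- w = c @- w'" "length c \<le> length u"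
  shows "\<exists>x. u = c @ x \<and> w' = x @- w"
  using assms
proof (induct c arbitrary: u)
  case (Cons a c)
  then show ?case by (cases u) auto
qed auto

section \<open>Table maps and their composition\<close>

lemma table_map_cases:
  assumes "table_map \<alpha> A B A' B' f"
  obtains n where "\<And>u. u \<in> words A B \<Longrightarrow> n \<le> length u \<Longrightarrow>
        (\<forall>w\<in>streams A. f (u @- w) = None) \<or>
        (\<exists>v\<in>words A' B'. \<forall>w\<in>streams A. f (u @- w) = Some (v @- smap \<alpha> w))"
  using assms unfolding table_map_def by blast

lemma table_map_in_ends:
  assumes "table_map \<alpha> A B A' B' f" "\<alpha> ` A \<subseteq> A'" "f z = Some y"
  shows "z \<in> ends A B" "y \<in> ends A' B'"
proof -
  show z: "z \<in> ends A B" using assms by (auto simp: table_map_def)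
  obtain n where n: "\<And>u. u \<in> words A B \<Longrightarrow> n \<le> length u \<Longrightarrow>
        (\<forall>w\<in>streams A. f (u @- w) = None) \<or>
        (\<exists>v\<in>words A' B'. \<forall>w\<in>streams A. f (u @- w) = Some (v @- smap \<alpha> w))"
    using table_map_cases[OF assms(1)] by blast
  obtain u w where uw: "z = u @- w" "u \<in> words A B" "w \<in> streams A" "n \<le> length u"
    using ends_split[OF z] by blast
  with n[of u] assms(3) obtain v where "v \<in> words A' B'" "y = v @- smap \<alpha> w" by force
  moreover have "smap \<alpha> w \<in> streams A'"
    using uw(3) assms(2) by (auto intro: smap_streams)
  ultimately show "y \<in> ends A' B'" by (simp add: shift_in_ends)
qed

text \<open>The bound for the composite is additive. A prefix of \<open>Suc n\<close> letters
  settles what \<open>f\<close> does. The at least \<open>m\<close> letters after it survive as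
  their \<open>\<alpha>\<close>-images, so the prefix after rewriting is long enough for the table
  of \<open>g\<close>, however short \<open>v\<close> is.\<close>

lemma table_map_comp:
  assumes f: "table_map \<alpha> A B A' B' f" and g: "table_map \<beta> A' B' A'' B'' g"
    and \<alpha>: "\<alpha> ` A \<subseteq> A'"
  shows "table_map (\<beta> \<circ> \<alpha>) A B A'' B'' (g \<circ>\<^sub>m f)"
proof -
  obtain n where n: "\<And>u. u \<in> words A B \<Longrightarrow> n \<le> length u \<Longrightarrow>
        (\<forall>w\<in>streams A. f (u @- w) = None) \<or>
        (\<exists>v\<in>words A' B'. \<forall>w\<in>streams A. f (u @- w) = Some (v @- smap \<alpha> w))"
    using table_map_cases[OF f] by blast
  obtain m where m: "\<And>u. u \<in> words A' B' \<Longrightarrow> m \<le> length u \<Longrightarrow>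
        (\<forall>w\<in>streams A'. g (u @- w) = None) \<or>
        (\<exists>v\<in>words A'' B''. \<forall>w\<in>streams A'. g (u @- w) = Some (v @- smap \<beta> w))"
    using table_map_cases[OF g] by blast
  have "(\<forall>w\<in>streams A. (g \<circ>\<^sub>m f) (u @- w) = None) \<or>
        (\<exists>v\<in>words A'' B''. \<forall>w\<in>streams A. (g \<circ>\<^sub>m f) (u @- w) = Some (v @- smap (\<beta> \<circ> \<alpha>) w))"
    if u: "u \<in> words A B" "Suc n + m \<le> length u" for u
  proof -
    \<comment> \<open>Cutting at \<open>Suc n\<close> instead of \<open>n\<close> keeps
      \<open>u1\<close> non-empty, hence in \<open>words A B\<close>, even for
      \<open>n = 0\<close>.\<close>
    define u1 x where "u1 = take (Suc n) u" and "x = drop (Suc n) u"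
    have ux: "u = u1 @ x" "length u1 = Suc n" "m \<le> length x"
      using u by (auto simp: u1_def x_def)
    have u1: "u1 \<in> words A B" and x: "x \<in> lists A"
      using u ux words_prefix[of u1 x A B] words_suffix[of u1 x A B] by force+
    have xw: "x @- w \<in> streams A" if "w \<in> streams A" for w
      using that x by (simp add: shift_streams)
    consider "\<forall>w\<in>streams A. f (u1 @- w) = None"
      | v where "v \<in> words A' B'" "\<forall>w\<in>streams A. f (u1 @- w) = Some (v @- smap \<alpha> w)"
      using n[OF u1] ux by auto
    then show ?thesis
    proof cases
      case 1
      then show ?thesis using xw ux by (auto simp: map_comp_def)
    next
      case 2
      have mx: "map \<alpha> x \<in> lists A'" using x \<alpha> by (induct x) auto
      have sm: "smap \<alpha> w \<in> streams A'" if "w \<in> streams A" for w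
        using that \<alpha> by (auto intro: smap_streams)
      have "f (u @- w) = Some ((v @ map \<alpha> x) @- smap \<alpha> w)" if "w \<in> streams A" for w
        using 2(2) xw[OF that] ux by simp
      then show ?thesis
        using m[OF words_append[OF 2(1) mx]] ux(3) sm
        by (auto simp: map_comp_def stream.map_comp)
    qed
  qed
  moreover have "dom (g \<circ>\<^sub>m f) \<subseteq> ends A B"
    using f by (auto simp: table_map_def map_comp_def split: option.splits)
  ultimately show ?thesis unfolding table_map_def by blast
qed

text \<open>Tails contain only letters of \<open>A\<close>. This turns the translation by two
  mutually inverse letter maps, whose composite is the identity on the alphabet only, into
  translation by \<open>id\<close>.\<close>

lemma table_map_cong:
  assumes "\<And>a. a \<in> A \<Longrightarrow> \<alpha> a = \<beta> a" "table_map \<alpha> A B A' B' f"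
  shows "table_map \<beta> A B A' B' f"
proof -
  have "smap \<alpha> w = smap \<beta> w" if "w \<in> streams A" for w
    using that assms(1) by (auto simp: streams_iff_sset intro!: stream.map_cong)
  then show ?thesis using assms(2) unfolding table_map_def by force
qed

section \<open>Isomorphisms by conjugation, and their inverses\<close>

lemma map_comp_assoc: "(h \<circ>\<^sub>m g) \<circ>\<^sub>m f = h \<circ>\<^sub>m (g \<circ>\<^sub>m f)"
  by (auto simp: map_comp_def fun_eq_iff split: option.splits)

lemma map_comp_restrict_left: "ran f \<subseteq> S \<Longrightarrow> (Some |` S) \<circ>\<^sub>m f = f"
  by (auto simp: map_comp_def fun_eq_iff ran_def restrict_map_def split: option.splits)

lemma map_comp_restrict_right:
  assumes "dom f \<subseteq> S" shows "f \<circ>\<^sub>m (Some |` S) = f"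
proof
  fix x
  have "f x = None" if "x \<notin> S" using that assms by blast
  then show "(f \<circ>\<^sub>m (Some |` S)) x = f x" by (cases "x \<in> S") (auto simp: map_comp_def)
qed

text \<open>Conjugation by \<open>\<theta>\<close> with inverse \<open>\<theta>'\<close>. The
  factors \<open>\<theta>' \<circ>\<^sub>m \<theta>\<close> and
  \<open>\<theta> \<circ>\<^sub>m \<theta>'\<close> that arise are restricted identities, which
  cancel because domain and range of a table map lie in \<open>ends\<close>.\<close>

lemma table_monoid_iso:
  assumes \<theta>: "table_map \<alpha> A B A' B' \<theta>" and \<theta>': "table_map \<alpha>' A' B' A B \<theta>'"
    and \<alpha>: "\<alpha> ` A \<subseteq> A'" and \<alpha>': "\<alpha>' ` A' \<subseteq> A"
    and inv: "\<And>a. a \<in> A \<Longrightarrow> \<alpha>' (\<alpha> a) = a" "\<And>a. a \<in> A' \<Longrightarrow> \<alpha> (\<alpha>' a) = a"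
    and id: "\<theta>' \<circ>\<^sub>m \<theta> = Some |` ends A B" "\<theta> \<circ>\<^sub>m \<theta>' = Some |` ends A' B'"
  shows "table_monoid A B \<cong> table_monoid A' B'"
proof -
  define F where "F f = \<theta> \<circ>\<^sub>m f \<circ>\<^sub>m \<theta>'" for f
  define G where "G f = \<theta>' \<circ>\<^sub>m f \<circ>\<^sub>m \<theta>" for f
  have F: "table_map Fun.id A' B' A' B' (F f)" if f: "table_map Fun.id A B A B f" for f
  proof -
    have "table_map (\<alpha> \<circ> Fun.id) A B A' B' (\<theta> \<circ>\<^sub>m f)"
      using table_map_comp[OF f \<theta>] by simp
    from table_map_comp[OF \<theta>' this \<alpha>'] show ?thesis
      unfolding F_def by (rule table_map_cong[rotated]) (simp add: inv)
  qed
  have G: "table_map Fun.id A B A B (G f)" if f: "table_map Fun.id A' B' A' B' f" for f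
  proof -
    have "table_map (\<alpha>' \<circ> Fun.id) A' B' A B (\<theta>' \<circ>\<^sub>m f)"
      using table_map_comp[OF f \<theta>'] by simp
    from table_map_comp[OF \<theta> this \<alpha>] show ?thesis
      unfolding G_def by (rule table_map_cong[rotated]) (simp add: inv)
  qed
  have dr: "dom f \<subseteq> ends A B" "ran f \<subseteq> ends A B"
    if "table_map Fun.id A B A B f" for A B :: "'c set" and f
    using table_map_in_ends[OF that] by (auto simp: ran_def)
  have GF: "G (F f) = f" if f: "table_map Fun.id A B A B f" for f
  proof -
    have "G (F f) = (\<theta>' \<circ>\<^sub>m \<theta>) \<circ>\<^sub>m f \<circ>\<^sub>m (\<theta>' \<circ>\<^sub>m \<theta>)" by (simp add: F_def G_def map_comp_assoc)
    then show ?thesis using dr[OF f] by (simp add: id map_comp_restrict_left map_comp_restrict_right)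
  qed
  have FG: "F (G f) = f" if f: "table_map Fun.id A' B' A' B' f" for f
  proof -
    have "F (G f) = (\<theta> \<circ>\<^sub>m \<theta>') \<circ>\<^sub>m f \<circ>\<^sub>m (\<theta> \<circ>\<^sub>m \<theta>')" by (simp add: F_def G_def map_comp_assoc)
    then show ?thesis using dr[OF f] by (simp add: id map_comp_restrict_left map_comp_restrict_right)
  qed
  have mult: "F (g \<circ>\<^sub>m f) = F g \<circ>\<^sub>m F f" if f: "table_map Fun.id A B A B f" for f g
  proof -
    have "F g \<circ>\<^sub>m F f = \<theta> \<circ>\<^sub>m g \<circ>\<^sub>m (((\<theta>' \<circ>\<^sub>m \<theta>) \<circ>\<^sub>m f) \<circ>\<^sub>m \<theta>')" by (simp add: F_def map_comp_assoc)
    also have "\<dots> = F (g \<circ>\<^sub>m f)"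
      using dr[OF f] by (simp add: id map_comp_restrict_left F_def map_comp_assoc)
    finally show ?thesis by simp
  qed
  have "F \<in> iso (table_monoid A B) (table_monoid A' B')"
  proof (rule isoI)
    show "F \<in> hom (table_monoid A B) (table_monoid A' B')"
      using F mult by (auto simp: hom_def table_monoid_def)
    show "bij_betw F (carrier (table_monoid A B)) (carrier (table_monoid A' B'))"
      by (rule bij_betw_byWitness[where f' = G]) (auto simp: table_monoid_def F G FG GF)
  qed
  then show ?thesis by (rule is_isoI)
qed

text \<open>The inverse of \<open>h\<close> is multiplicative because \<open>h\<close> is injective
  on the carrier; closure ensures that the product of the two preimages lies there.\<close>

lemma iso_sym_closed:
  assumes "G \<cong> H" and closed: "\<And>x y. x \<in> carrier G \<Longrightarrow> y \<in> carrier G \<Longrightarrow> x \<otimes>\<^bsub>G\<^esub> y \<in> carrier G"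
  shows "H \<cong> G"
proof -
  obtain h where h: "h \<in> hom G H" "bij_betw h (carrier G) (carrier H)"
    using assms(1) by (auto simp: is_iso_def iso_def)
  let ?g = "inv_into (carrier G) h"
  have g: "bij_betw ?g (carrier H) (carrier G)" using h(2) by (rule bij_betw_inv_into)
  have "?g (x \<otimes>\<^bsub>H\<^esub> y) = ?g x \<otimes>\<^bsub>G\<^esub> ?g y" if xy: "x \<in> carrier H" "y \<in> carrier H" for x y
  proof -
    have c: "?g x \<in> carrier G" "?g y \<in> carrier G"
      using xy g by (auto simp: bij_betw_def)
    have "h (?g x \<otimes>\<^bsub>G\<^esub> ?g y) = x \<otimes>\<^bsub>H\<^esub> y"
      using h c xy by (simp add: hom_mult bij_betw_inv_into_right)
    then show ?thesis using closed[OF c] h(2) by (metis bij_betw_inv_into_left)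
  qed
  then have "?g \<in> iso H G"
    using g by (auto simp: iso_def hom_def bij_betw_def)
  then show ?thesis by (rule is_isoI)
qed

lemma table_monoid_closed:
  "f \<in> carrier (table_monoid A B) \<Longrightarrow> g \<in> carrier (table_monoid A B) \<Longrightarrow>
   f \<otimes>\<^bsub>table_monoid A B\<^esub> g \<in> carrier (table_monoid A B)"
  using table_map_comp[of id A B A B g id A B f] by (simp add: table_monoid_def)

section \<open>The action of right ideal homomorphisms on infinite words\<close>

text \<open>An infinite word may have many prefixes in the domain, hence the choice; by
  \<open>action_shift\<close> all of them give the same image when \<open>\<phi>\<close> is a right
  ideal homomorphism.\<close>

definition action :: "'a set \<Rightarrow> ('a list \<rightharpoonup> 'a list) \<Rightarrow> ('a stream \<rightharpoonup> 'a stream)" where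
  "action A \<phi> z =
     (if \<exists>u\<in>dom \<phi>. \<exists>w\<in>streams A. z = u @- w
      then Some (SOME y. \<exists>u v w. z = u @- w \<and> \<phi> u = Some v \<and> w \<in> streams A \<and> y = v @- w)
      else None)"

text \<open>The way back from a table map \<open>f\<close>: its graph consists of all rewritings
  valid for every tail, so it contains every homomorphism that induces \<open>f\<close>. The
  description is proper by \<open>eq_if_shift_eq\<close>.\<close>

definition max_hom :: "'a set \<Rightarrow> 'a set \<Rightarrow> ('a stream \<rightharpoonup> 'a stream) \<Rightarrow> ('a list \<rightharpoonup> 'a list)" where
  "max_hom A B f u =
     (if u \<in> words A B \<and> (\<exists>v\<in>words A B. \<forall>w\<in>streams A. f (u @- w) = Some (v @- w))
      then Some (THE v. v \<in> words A B \<and> (\<forall>w\<in>streams A. f (u @- w) = Some (v @- w)))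
      else None)"

section \<open>Recovering finite words from their infinite continuations\<close>

locale alphabets =
  fixes A B :: "'a set"
  assumes finite_A: "finite A" and finite_B: "finite B" and card_A: "2 \<le> card A"
begin

lemma ex_other_letter: "\<exists>a\<in>A. a \<noteq> c"
proof (rule ccontr)
  assume "\<not> ?thesis"
  then have "A \<subseteq> {c}" by auto
  then have "card A \<le> 1" using card_mono[of "{c}" A] by simp
  then show False using card_A by simp
qed

lemma streams_nonempty: "\<exists>w. w \<in> streams A"
proof -
  obtain a where "a \<in> A" using ex_other_letter by blast
  then have "sconst a \<in> streams A" by (simp add: streams_iff_sset)
  then show ?thesis by blast
qed

text \<open>If \<open>v'\<close> were longer than \<open>v\<close> by a non-empty \<open>x\<close>,
  every infinite word over \<open>A\<close> would begin with the first letter of \<open>x\<close>;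
  repeating another letter of \<open>A\<close> forever contradicts this. Here \<open>A\<close> must
  have two letters.\<close>

lemma eq_if_shift_eq_aux:
  assumes "\<And>w. w \<in> streams A \<Longrightarrow> v @- w = v' @- w" "length v \<le> length v'"
  shows "v = v'"
proof -
  have x: "\<exists>x. v' = v @ x \<and> w = x @- w" if "w \<in> streams A" for w
    using shift_eq_shiftD[of v' w v w] assms that by metis
  then obtain x where x1: "v' = v @ x" using streams_nonempty by blast
  with x have x2: "w = x @- w" if "w \<in> streams A" for w using that by fastforce
  show ?thesis
  proof (cases x)
    case (Cons c y)
    obtain a where "a \<in> A" "a \<noteq> c" using ex_other_letter by blast
    then have "sconst a \<in> streams A" by (simp add: streams_iff_sset)
    from arg_cong[OF x2[OF this], of shd] show ?thesis using Cons \<open>a \<noteq> c\<close> by simp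
  qed (simp add: x1)
qed

lemma eq_if_shift_eq:
  assumes "\<And>w. w \<in> streams A \<Longrightarrow> v @- w = v' @- w"
  shows "v = v'"
  using eq_if_shift_eq_aux[of v v'] eq_if_shift_eq_aux[of v' v] assms by (metis nle_le)

lemma max_hom_eq_Some_iff:
  "max_hom A B f u = Some v \<longleftrightarrow>
     u \<in> words A B \<and> v \<in> words A B \<and> (\<forall>w\<in>streams A. f (u @- w) = Some (v @- w))"
proof -
  let ?P = "\<lambda>v. v \<in> words A B \<and> (\<forall>w\<in>streams A. f (u @- w) = Some (v @- w))"
  have the: "(THE v. ?P v) = v" if "?P v" for v
    using that by (intro the_equality) (auto intro: eq_if_shift_eq)
  show ?thesis unfolding max_hom_def using the by auto
qed

section \<open>Finitely generated right ideals and homomorphisms\<close>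

text \<open>Over finite alphabets there are finitely many words of bounded length, so finite
  generation amounts to a bound on the length of generators. The later proofs only compute such
  bounds.\<close>

lemma fin_gen_right_ideal_iff:
  "fin_gen_right_ideal A B R \<longleftrightarrow>
     R \<subseteq> words A B \<and> (\<forall>u\<in>R. \<forall>x\<in>lists A. u @ x \<in> R) \<and>
     (\<exists>N. \<forall>u\<in>R. \<exists>c\<in>R. \<exists>y. u = c @ y \<and> length c \<le> N)"
  (is "?L \<longleftrightarrow> ?R")
proof
  assume ?L
  then obtain C where C: "R \<subseteq> words A B" "times_star A R = R" "finite C" "R = times_star A C"
    by (auto simp: fin_gen_right_ideal_def right_ideal_def)
  have "C \<subseteq> R" using C(4) by (force simp: times_star_def)
  \<comment> \<open>If \<open>C\<close> is empty, \<open>Max\<close> has an unspecified value, but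
    then \<open>R\<close> is empty too.\<close>
  have "\<forall>u\<in>R. \<exists>c\<in>R. \<exists>y. u = c @ y \<and> length c \<le> Max (length ` C)"
  proof
    fix u assume "u \<in> R"
    then obtain c y where "c \<in> C" "u = c @ y" using C(4) by (auto simp: times_star_def)
    then show "\<exists>c\<in>R. \<exists>y. u = c @ y \<and> length c \<le> Max (length ` C)"
      using \<open>C \<subseteq> R\<close> C(3) by (intro bexI[of _ c]) auto
  qed
  moreover have "\<forall>u\<in>R. \<forall>x\<in>lists A. u @ x \<in> R"
  proof (intro ballI)
    fix u x assume "u \<in> R" "x \<in> lists A"
    then have "u @ x \<in> times_star A R" unfolding times_star_def by blast
    then show "u @ x \<in> R" by (simp only: C(2))
  qed
  ultimately show ?R using C(1) by blast
next
  assume ?R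
  then obtain N where R: "R \<subseteq> words A B" "\<And>u x. u \<in> R \<Longrightarrow> x \<in> lists A \<Longrightarrow> u @ x \<in> R"
    "\<And>u. u \<in> R \<Longrightarrow> \<exists>c\<in>R. \<exists>y. u = c @ y \<and> length c \<le> N" by blast
  let ?C = "{c \<in> R. length c \<le> N}"
  have "finite ?C"
    by (rule finite_subset[OF _ finite_words_le[OF finite_A finite_B, of N]]) (use R(1) in auto)
  moreover have "R = times_star A ?C"
  proof
    show "R \<subseteq> times_star A ?C"
    proof
      fix u assume u: "u \<in> R"
      then obtain c y where c: "c \<in> R" "u = c @ y" "length c \<le> N" using R(3) by blast
      moreover have "y \<in> lists A"
        using words_suffix[of c y A B] u c R(1) Nil_notin_words by (metis subsetD)
      ultimately show "u \<in> times_star A ?C" unfolding times_star_def by blast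
    qed
    show "times_star A ?C \<subseteq> R" using R(2) by (auto simp: times_star_def)
  qed
  moreover have "times_star A R = R"
  proof
    show "times_star A R \<subseteq> R" using R(2) by (auto simp: times_star_def)
    show "R \<subseteq> times_star A R" by (force simp: times_star_def)
  qed
  ultimately show ?L using R(1) unfolding fin_gen_right_ideal_def right_ideal_def by blast
qed

text \<open>A length bound for the domain suffices: the images of its finitely many short elements
  generate the range, and the longest of them bounds generators there.\<close>

lemma right_ideal_homI:
  assumes "\<And>u v. \<phi> u = Some v \<Longrightarrow> u \<in> words A B \<and> v \<in> words A B"
    and app: "\<And>u v x. \<phi> u = Some v \<Longrightarrow> x \<in> lists A \<Longrightarrow> \<phi> (u @ x) = Some (v @ x)"
    and gen: "\<And>u. u \<in> dom \<phi> \<Longrightarrow> \<exists>c\<in>dom \<phi>. \<exists>y. u = c @ y \<and> length c \<le> N"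
  shows "right_ideal_hom A B \<phi>"
proof -
  have "fin_gen_right_ideal A B (dom \<phi>)"
    unfolding fin_gen_right_ideal_iff
  proof (intro conjI ballI exI[of _ N])
    show "dom \<phi> \<subseteq> words A B" using assms(1) by blast
    show "u @ x \<in> dom \<phi>" if "u \<in> dom \<phi>" "x \<in> lists A" for u x using that app by blast
  qed (rule gen)
  moreover have "fin_gen_right_ideal A B (ran \<phi>)"
  proof -
    let ?C = "{c \<in> dom \<phi>. length c \<le> N}"
    let ?M = "Max ((\<lambda>c. length (the (\<phi> c))) ` ?C)"
    have fin: "finite ?C"
      by (rule finite_subset[OF _ finite_words_le[OF finite_A finite_B, of N]])
        (use assms(1) in auto)
    have "\<exists>d\<in>ran \<phi>. \<exists>y. v = d @ y \<and> length d \<le> ?M" if v: "v \<in> ran \<phi>" for v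
    proof -
      obtain u where u: "\<phi> u = Some v" using v by (auto simp: ran_def)
      then obtain c y d where c: "\<phi> c = Some d" "u = c @ y" "length c \<le> N"
        using gen[of u] by blast
      have "y \<in> lists A"
        using words_suffix[of c y A B] assms(1)[OF u] assms(1)[OF c(1)] c(2) Nil_notin_words by metis
      then have "v = d @ y" using app[OF c(1)] u c(2) by simp
      moreover have "length d \<le> ?M"
        using fin c by (intro Max_ge) (auto intro!: image_eqI[of _ _ c])
      ultimately show ?thesis using c(1) by (auto simp: ran_def)
    qed
    moreover have "v @ x \<in> ran \<phi>" if "v \<in> ran \<phi>" "x \<in> lists A" for v x
      using that app by (fastforce simp: ran_def)
    moreover have "ran \<phi> \<subseteq> words A B" using assms(1) by (auto simp: ran_def)
    ultimately show ?thesis unfolding fin_gen_right_ideal_iff by blast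
  qed
  moreover have "\<phi> (u @ x) = Some (the (\<phi> u) @ x)" if "u \<in> dom \<phi>" "x \<in> lists A" for u x
    using that app by force
  ultimately show ?thesis unfolding right_ideal_hom_def by blast
qed

lemma right_ideal_hom_words:
  assumes "right_ideal_hom A B \<phi>" "\<phi> u = Some v"
  shows "u \<in> words A B" "v \<in> words A B"
  using assms by (auto simp: right_ideal_hom_def fin_gen_right_ideal_iff ran_def)

lemma right_ideal_hom_append:
  assumes "right_ideal_hom A B \<phi>" "\<phi> u = Some v" "x \<in> lists A"
  shows "\<phi> (u @ x) = Some (v @ x)"
  using assms by (force simp: right_ideal_hom_def)

lemma right_ideal_hom_generators:
  assumes "right_ideal_hom A B \<phi>"
  obtains N where "\<And>u. u \<in> dom \<phi> \<Longrightarrow> \<exists>c\<in>dom \<phi>. \<exists>y. u = c @ y \<and> length c \<le> N"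
proof -
  have "fin_gen_right_ideal A B (dom \<phi>)" using assms by (simp add: right_ideal_hom_def)
  then show ?thesis using that unfolding fin_gen_right_ideal_iff by blast
qed

text \<open>A generator that is a prefix of \<open>u @ x\<close> and no longer than \<open>u\<close>
  is already a prefix of \<open>u\<close>. So a long word is either in the domain or has no
  extension in it, which is the alternative in \<open>table_map\<close>.\<close>

lemma right_ideal_hom_long_words:
  assumes "right_ideal_hom A B \<phi>"
  obtains N where "\<And>u x. u \<in> words A B \<Longrightarrow> N \<le> length u \<Longrightarrow> u @ x \<in> dom \<phi> \<Longrightarrow> u \<in> dom \<phi>"
proof -
  obtain N where N: "\<And>u. u \<in> dom \<phi> \<Longrightarrow> \<exists>c\<in>dom \<phi>. \<exists>y. u = c @ y \<and> length c \<le> N"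
    using right_ideal_hom_generators[OF assms] by blast
  have "u \<in> dom \<phi>" if u: "u \<in> words A B" "N \<le> length u" "u @ x \<in> dom \<phi>" for u x
  proof -
    obtain c y where c: "c \<in> dom \<phi>" "u @ x = c @ y" "length c \<le> N" using N[OF u(3)] by blast
    have "length c \<le> length u" using c(3) u(2) by simp
    then have "take (length c) (u @ x) = take (length c) u" by simp
    then have "u = c @ drop (length c) u" using c(2) by (metis append_eq_conv_conj append_take_drop_id)
    then obtain y' where y': "u = c @ y'" by blast
    moreover have "c \<in> words A B" using c(1) right_ideal_hom_words[OF assms] by blast
    ultimately have "y' \<in> lists A"
      using u(1) words_suffix[of c y' A B] by fastforce
    then show ?thesis using right_ideal_hom_append[OF assms] c(1) y' by blast
  qed
  then show ?thesis using that by blast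
qed

section \<open>Passing between homomorphisms and table maps\<close>

text \<open>Of two prefixes in the domain the longer is the shorter followed by some
  \<open>x\<close>, and \<open>\<phi>\<close> commutes with appending \<open>x\<close>; both
  therefore yield the same infinite word.\<close>

lemma action_shift:
  assumes hom: "right_ideal_hom A B \<phi>" and uvw: "\<phi> u = Some v" "w \<in> streams A"
  shows "action A \<phi> (u @- w) = Some (v @- w)"
proof -
  \<comment> \<open>Only the case in which the second prefix is the shorter; the other one follows
    by exchanging the roles.\<close>
  have le: "v @- w = v' @- w'"
    if h: "\<phi> u = Some v" "\<phi> u' = Some v'" "u @- w = u' @- w'" "length u' \<le> length u" "w' \<in> streams A"
    for u v w u' v' w'
  proof -
    obtain x where x: "u = u' @ x" "w' = x @- w"
      using shift_eq_shiftD[of u w u' w'] h by blast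
    then have "x \<in> lists A" using h(5) shift_streamsD by blast
    then have "v = v' @ x" using right_ideal_hom_append[OF hom h(2)] h(1) x by simp
    then show ?thesis using x by simp
  qed
  have eq: "y = v @- w"
    if "\<exists>u' v' w'. u @- w = u' @- w' \<and> \<phi> u' = Some v' \<and> w' \<in> streams A \<and> y = v' @- w'" for y
    using that le uvw by (metis nle_le)
  let ?P = "\<lambda>y. \<exists>u' v' w'. u @- w = u' @- w' \<and> \<phi> u' = Some v' \<and> w' \<in> streams A \<and> y = v' @- w'"
  have "?P (v @- w)" using uvw by blast
  then have "?P (SOME y. ?P y)" by (rule someI)
  then have "(SOME y. ?P y) = v @- w" by (rule eq)
  moreover have "\<exists>u'\<in>dom \<phi>. \<exists>w'\<in>streams A. u @- w = u' @- w'" using uvw by blast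
  ultimately show ?thesis unfolding action_def by simp
qed

text \<open>Moving \<open>m\<close> letters from the tail to both prefixes makes them as long as
  desired. Later proofs choose \<open>m\<close> so that the prefixes become comparable with a given
  word.\<close>

lemma action_SomeE:
  assumes hom: "right_ideal_hom A B \<phi>" and "action A \<phi> z = Some y"
  obtains u v w where "z = u @- w" "y = v @- w" "\<phi> u = Some v" "w \<in> streams A"
    "m \<le> length u" "m \<le> length v"
proof -
  obtain u w where "u \<in> dom \<phi>" "w \<in> streams A" "z = u @- w"
    using assms(2) unfolding action_def by (auto split: if_splits)
  then obtain v where u: "\<phi> u = Some v" "w \<in> streams A" "z = u @- w" by blast
  with action_shift[OF hom u(1,2)] assms(2) have y: "y = v @- w" by simp
  have "stake m w \<in> lists A" using u stake_streams by blast
  then have "\<phi> (u @ stake m w) = Some (v @ stake m w)"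
    using right_ideal_hom_append[OF hom] u by blast
  then show ?thesis
    using that[of "u @ stake m w" "sdrop m w" "v @ stake m w"] u y sdrop_streams[OF u(2)]
    by (simp add: stake_sdrop)
qed

lemma table_map_action:
  assumes hom: "right_ideal_hom A B \<phi>"
  shows "table_map id A B A B (action A \<phi>)"
proof -
  obtain N where N: "\<And>u x. u \<in> words A B \<Longrightarrow> N \<le> length u \<Longrightarrow> u @ x \<in> dom \<phi> \<Longrightarrow> u \<in> dom \<phi>"
    using right_ideal_hom_long_words[OF hom] by blast
  have "(\<forall>w\<in>streams A. action A \<phi> (u @- w) = None) \<or>
        (\<exists>v\<in>words A B. \<forall>w\<in>streams A. action A \<phi> (u @- w) = Some (v @- smap id w))"
    if u: "u \<in> words A B" "N \<le> length u" for u
  proof (cases "u \<in> dom \<phi>")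
    case True
    then show ?thesis
      using action_shift[OF hom] right_ideal_hom_words[OF hom] by (fastforce simp: stream.map_id)
  next
    case False
    have "action A \<phi> (u @- w) = None" for w
    proof (rule ccontr)
      assume "action A \<phi> (u @- w) \<noteq> None"
      then obtain y where "action A \<phi> (u @- w) = Some y" by blast
      then obtain u' v' w' where "u @- w = u' @- w'" "\<phi> u' = Some v'" "length u \<le> length u'"
        \<comment> \<open>The choice of \<open>m\<close> makes \<open>u\<close> a prefix of
          \<open>u'\<close>, so that an extension of \<open>u\<close> lies in the domain.\<close>
        using action_SomeE[OF hom, where m = "length u"] by metis
      then have "\<exists>x. u @ x \<in> dom \<phi>" using shift_eq_shiftD[of u' w' u w] by auto
      then show False using N u False by blast
    qed
    then show ?thesis by blast
  qed
  moreover have "dom (action A \<phi>) \<subseteq> ends A B"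
  proof
    fix z assume "z \<in> dom (action A \<phi>)"
    then obtain y where "action A \<phi> z = Some y" by blast
    then show "z \<in> ends A B"
      using action_SomeE[OF hom] right_ideal_hom_words[OF hom] shift_in_ends by metis
  qed
  ultimately show ?thesis unfolding table_map_def by blast
qed

text \<open>The domain is generated by words of length at most \<open>Suc n\<close>. A longer
  \<open>u\<close> in it has a prefix \<open>c\<close> of that length, and \<open>f\<close> is
  defined on some continuation of \<open>c\<close>; the table then rewrites \<open>c\<close>
  itself.\<close>

lemma right_ideal_hom_max_hom:
  assumes f: "table_map id A B A B f"
  shows "right_ideal_hom A B (max_hom A B f)"
proof -
  obtain n where n: "\<And>u. u \<in> words A B \<Longrightarrow> n \<le> length u \<Longrightarrow>
        (\<forall>w\<in>streams A. f (u @- w) = None) \<or>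
        (\<exists>v\<in>words A B. \<forall>w\<in>streams A. f (u @- w) = Some (v @- smap id w))"
    using table_map_cases[OF f] by blast
  show ?thesis
  proof (rule right_ideal_homI)
    fix u v assume uv: "max_hom A B f u = Some v"
    then show "u \<in> words A B \<and> v \<in> words A B" by (simp add: max_hom_eq_Some_iff)
    fix x assume x: "x \<in> lists A"
    then have "x @- w \<in> streams A" if "w \<in> streams A" for w using that shift_streams by blast
    then show "max_hom A B f (u @ x) = Some (v @ x)"
      using uv x by (simp add: max_hom_eq_Some_iff words_append)
  next
    fix u assume u: "u \<in> dom (max_hom A B f)"
    show "\<exists>c\<in>dom (max_hom A B f). \<exists>y. u = c @ y \<and> length c \<le> Suc n"
    proof (cases "length u \<le> Suc n")
      case True
      then show ?thesis using u by (intro bexI[of _ u] exI[of _ "[]"]) auto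
    next
      case False
      define c x where "c = take (Suc n) u" and "x = drop (Suc n) u"
      have cx: "u = c @ x" "length c = Suc n" using False by (auto simp: c_def x_def)
      obtain v where v: "u \<in> words A B" "\<And>w. w \<in> streams A \<Longrightarrow> f (u @- w) = Some (v @- w)"
        using u by (auto simp: max_hom_eq_Some_iff)
      have c: "c \<in> words A B" "x \<in> lists A"
        using v(1) cx words_prefix[of c x A B] words_suffix[of c x A B] by force+
      obtain w where w: "w \<in> streams A" using streams_nonempty by blast
      then have "x @- w \<in> streams A" using c(2) by (simp add: shift_streams)
      moreover have "f (c @- x @- w) \<noteq> None" using v(2)[OF w] cx by simp
      ultimately obtain v' where "v' \<in> words A B" "\<forall>w\<in>streams A. f (c @- w) = Some (v' @- smap id w)"
        using n[OF c(1)] cx by auto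
      then have "max_hom A B f c = Some v'"
        using c by (simp add: max_hom_eq_Some_iff stream.map_id)
      then show ?thesis using cx by (intro bexI[of _ c] exI[of _ x]) auto
    qed
  qed
qed

lemma action_max_hom:
  assumes f: "table_map id A B A B f"
  shows "action A (max_hom A B f) = f"
proof -
  have hom: "right_ideal_hom A B (max_hom A B f)" by (rule right_ideal_hom_max_hom[OF f])
  have sub: "f z = Some y" if "action A (max_hom A B f) z = Some y" for z y
    using action_SomeE[OF hom that] max_hom_eq_Some_iff by metis
  have sup: "action A (max_hom A B f) z = Some y" if z: "f z = Some y" for z y
  proof -
    obtain n where n: "\<And>u. u \<in> words A B \<Longrightarrow> n \<le> length u \<Longrightarrow>
        (\<forall>w\<in>streams A. f (u @- w) = None) \<or>
        (\<exists>v\<in>words A B. \<forall>w\<in>streams A. f (u @- w) = Some (v @- smap id w))"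
      using table_map_cases[OF f] by blast
    have "z \<in> ends A B" using f z by (auto simp: table_map_def)
    then obtain u w where uw: "z = u @- w" "u \<in> words A B" "w \<in> streams A" "n \<le> length u"
      using ends_split by blast
    then obtain v where v: "v \<in> words A B" "\<forall>w\<in>streams A. f (u @- w) = Some (v @- smap id w)"
      using n[of u] z by force
    then have "max_hom A B f u = Some v"
      using uw by (simp add: max_hom_eq_Some_iff stream.map_id)
    from action_shift[OF hom this uw(3)] show ?thesis using z v uw by (simp add: stream.map_id)
  qed
  show ?thesis using sub sup by (metis option.exhaust ext)
qed

section \<open>Maximal extensions\<close>

lemma map_le_max_hom_action:
  assumes "right_ideal_hom A B \<phi>" shows "\<phi> \<subseteq>\<^sub>m max_hom A B (action A \<phi>)"
proof -
  have "max_hom A B (action A \<phi>) u = Some v" if "\<phi> u = Some v" for u v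
    using that action_shift[OF assms] right_ideal_hom_words[OF assms]
    by (simp add: max_hom_eq_Some_iff)
  then show ?thesis by (force simp: map_le_def)
qed

text \<open>The extension acts at least where \<open>\<phi>\<close> does and in the same way.
  Essential equality shows that it acts nowhere else, by testing it on the principal right ideals of
  long words.\<close>

lemma action_ess_equal_extension:
  assumes \<phi>: "right_ideal_hom A B \<phi>" and ext: "ess_equal_extension A B \<phi> \<chi>"
  shows "action A \<chi> = action A \<phi>"
proof -
  have \<chi>: "right_ideal_hom A B \<chi>" and le: "\<phi> \<subseteq>\<^sub>m \<chi>"
    and ess: "\<And>R. right_ideal A B R \<Longrightarrow> R \<inter> dom \<phi> \<noteq> {} \<longleftrightarrow> R \<inter> dom \<chi> \<noteq> {}"
    using ext by (auto simp: ess_equal_extension_def ess_equal_homs_def ess_equal_ideals_def)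
  have sub: "action A \<chi> z = Some y" if z: "action A \<phi> z = Some y" for z y
  proof -
    obtain u v w where uvw: "z = u @- w" "y = v @- w" "\<phi> u = Some v" "w \<in> streams A"
      using action_SomeE[OF \<phi> z] by metis
    have "\<chi> u = Some v" using le uvw(3) by (force simp: map_le_def)
    then show ?thesis using action_shift[OF \<chi>] uvw by blast
  qed
  \<comment> \<open>Definedness suffices, since \<open>sub\<close> fixes the value.\<close>
  have sup: "action A \<phi> z \<noteq> None" if z: "action A \<chi> z = Some y" for z y
  proof -
    obtain N where N: "\<And>u x. u \<in> words A B \<Longrightarrow> N \<le> length u \<Longrightarrow> u @ x \<in> dom \<phi> \<Longrightarrow> u \<in> dom \<phi>"
      using right_ideal_hom_long_words[OF \<phi>] by blast
    obtain u v w where u: "z = u @- w" "\<chi> u = Some v" "w \<in> streams A" "N \<le> length u"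
      using action_SomeE[OF \<chi> z, where m = N] by metis
    have uw: "u \<in> words A B" using right_ideal_hom_words[OF \<chi> u(2)] by blast
    \<comment> \<open>The right ideal generated by \<open>u\<close> meets \<open>dom \<chi>\<close>,
      hence \<open>dom \<phi>\<close>; so some extension of \<open>u\<close> is in
      \<open>dom \<phi>\<close>, and \<open>u\<close> itself is, being long.\<close>
    let ?R = "times_star A {u}"
    have "times_star A ?R = ?R"
      by (auto simp: times_star_def)
    then have "right_ideal A B ?R"
      using uw words_append by (fastforce simp: right_ideal_def times_star_def)
    moreover have "u \<in> ?R" by (force simp: times_star_def)
    ultimately obtain r where "r \<in> ?R" "r \<in> dom \<phi>" using ess[of ?R] u(2) by blast
    then have "u \<in> dom \<phi>" using N[OF uw u(4)] by (auto simp: times_star_def)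
    then show ?thesis using action_shift[OF \<phi>] u by fastforce
  qed
  show ?thesis
  proof
    fix z
    show "action A \<chi> z = action A \<phi> z"
      using sub sup by (cases "action A \<phi> z"; cases "action A \<chi> z") force+
  qed
qed

text \<open>A right ideal meeting the larger domain in \<open>u\<close> contains all extensions of
  \<open>u\<close>. Since the action is defined on the continuations of \<open>u\<close>, one of
  these extensions lies in \<open>dom \<phi>\<close>.\<close>

lemma ess_equal_extension_max_hom:
  assumes \<phi>: "right_ideal_hom A B \<phi>"
  shows "ess_equal_extension A B \<phi> (max_hom A B (action A \<phi>))"
proof -
  let ?\<psi> = "max_hom A B (action A \<phi>)"
  have le: "\<phi> \<subseteq>\<^sub>m ?\<psi>" by (rule map_le_max_hom_action[OF \<phi>])
  have "R \<inter> dom \<phi> \<noteq> {}" if R: "right_ideal A B R" and ne: "R \<inter> dom ?\<psi> \<noteq> {}" for R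
  proof -
    obtain u v where u: "u \<in> R" "?\<psi> u = Some v" using ne by blast
    obtain w where w: "w \<in> streams A" using streams_nonempty by blast
    have "action A \<phi> (u @- w) = Some (v @- w)" using u(2) w by (simp add: max_hom_eq_Some_iff)
    then obtain u' v' w' where u': "u @- w = u' @- w'" "\<phi> u' = Some v'" "length u \<le> length u'"
      using action_SomeE[OF \<phi>, where m = "length u"] by metis
    then obtain x where x: "u' = u @ x" "w = x @- w'" using shift_eq_shiftD[of u' w' u w] by auto
    then have "x \<in> lists A" using w shift_streamsD by blast
    then have "u' \<in> R" using R u(1) x unfolding right_ideal_def times_star_def by blast
    then show ?thesis using u'(2) by blast
  qed
  moreover have "dom \<phi> \<subseteq> dom ?\<psi>" using le by (rule map_le_implies_dom_le)
  ultimately have "ess_equal_ideals A B (dom \<phi>) (dom ?\<psi>)"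
    unfolding ess_equal_ideals_def by (metis Int_mono order_refl subset_empty)
  then show ?thesis
    using le right_ideal_hom_max_hom[OF table_map_action[OF \<phi>]]
    by (auto simp: ess_equal_extension_def ess_equal_homs_def map_le_def)
qed

text \<open>All essentially equal extensions have the action of \<open>\<phi>\<close>, so they lie
  below \<open>max_hom\<close> of that action, which is itself one of them. A greatest element is
  the only maximal one.\<close>

lemma max_extension_eq:
  assumes \<phi>: "right_ideal_hom A B \<phi>"
  shows "max_extension A B \<phi> = max_hom A B (action A \<phi>)"
proof -
  let ?\<psi> = "max_hom A B (action A \<phi>)"
  have ext: "ess_equal_extension A B \<phi> ?\<psi>" by (rule ess_equal_extension_max_hom[OF \<phi>])
  have le: "\<chi> \<subseteq>\<^sub>m ?\<psi>" if "ess_equal_extension A B \<phi> \<chi>" for \<chi>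
    using map_le_max_hom_action[of \<chi>] action_ess_equal_extension[OF \<phi> that] that
    by (auto simp: ess_equal_extension_def)
  show ?thesis unfolding max_extension_def
    using ext le by (intro the_equality) (auto intro: map_le_antisym)
qed

section \<open>Products, and the isomorphism with the table monoid\<close>

lemma right_ideal_hom_comp:
  assumes \<phi>: "right_ideal_hom A B \<phi>" and \<psi>: "right_ideal_hom A B \<psi>"
  shows "right_ideal_hom A B (\<psi> \<circ>\<^sub>m \<phi>)"
proof -
  obtain N where N: "\<And>u. u \<in> dom \<phi> \<Longrightarrow> \<exists>c\<in>dom \<phi>. \<exists>y. u = c @ y \<and> length c \<le> N"
    using right_ideal_hom_generators[OF \<phi>] by blast
  obtain M where M: "\<And>u x. u \<in> words A B \<Longrightarrow> M \<le> length u \<Longrightarrow> u @ x \<in> dom \<psi> \<Longrightarrow> u \<in> dom \<psi>"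
    using right_ideal_hom_long_words[OF \<psi>] by blast
  show ?thesis
  proof (rule right_ideal_homI)
    fix u v assume uv: "(\<psi> \<circ>\<^sub>m \<phi>) u = Some v"
    then obtain t where t: "\<phi> u = Some t" "\<psi> t = Some v" by (auto simp: map_comp_Some_iff)
    then show "u \<in> words A B \<and> v \<in> words A B"
      using right_ideal_hom_words \<phi> \<psi> by blast
    show "(\<psi> \<circ>\<^sub>m \<phi>) (u @ x) = Some (v @ x)" if "x \<in> lists A" for x
      using right_ideal_hom_append[OF \<phi> t(1) that] right_ideal_hom_append[OF \<psi> t(2) that] by simp
  next
    fix u assume "u \<in> dom (\<psi> \<circ>\<^sub>m \<phi>)"
    then obtain t v where t: "\<phi> u = Some t" "\<psi> t = Some v" by (auto simp: map_comp_Some_iff)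
    then obtain c y d where c: "\<phi> c = Some d" "u = c @ y" "length c \<le> N" using N[of u] by blast
    have "y \<in> lists A"
      using words_suffix[of c y A B] right_ideal_hom_words[OF \<phi>] t(1) c Nil_notin_words by metis
    \<comment> \<open>At most \<open>M\<close> letters beyond the generator \<open>c\<close> are
      kept. If \<open>y\<close> has that many, \<open>d @ y1\<close> is long enough to be in
      \<open>dom \<psi>\<close> because its extension \<open>t\<close> is; otherwise
      \<open>y1\<close> is all of \<open>y\<close>.\<close>
    define y1 y2 where "y1 = take M y" and "y2 = drop M y"
    have y: "y = y1 @ y2" by (simp add: y1_def y2_def)
    then have yA: "y1 \<in> lists A" "y2 \<in> lists A" using \<open>y \<in> lists A\<close> by auto
    have d1: "\<phi> (c @ y1) = Some (d @ y1)" using right_ideal_hom_append[OF \<phi> c(1) yA(1)] .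
    have dt: "t = d @ y1 @ y2"
      using right_ideal_hom_append[OF \<phi> c(1) \<open>y \<in> lists A\<close>] t(1) c(2) y by simp
    have "d @ y1 \<in> dom \<psi>"
    proof (cases "M \<le> length y")
      case True
      then show ?thesis
        using M[of "d @ y1" y2] right_ideal_hom_words(2)[OF \<phi> d1] dt t(2) by (auto simp: y1_def)
    next
      case False
      then have "y2 = []" by (simp add: y2_def)
      then show ?thesis using dt t(2) by auto
    qed
    then have "c @ y1 \<in> dom (\<psi> \<circ>\<^sub>m \<phi>)" using d1 by auto
    moreover have "u = (c @ y1) @ y2" "length (c @ y1) \<le> N + M"
      using c(2,3) by (simp_all add: y1_def y2_def)
    ultimately show "\<exists>c\<in>dom (\<psi> \<circ>\<^sub>m \<phi>). \<exists>y. u = c @ y \<and> length c \<le> N + M" by blast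
  qed
qed

lemma action_comp:
  assumes \<phi>: "right_ideal_hom A B \<phi>" and \<psi>: "right_ideal_hom A B \<psi>"
  shows "action A (\<psi> \<circ>\<^sub>m \<phi>) = action A \<psi> \<circ>\<^sub>m action A \<phi>"
proof -
  note comp = right_ideal_hom_comp[OF \<phi> \<psi>]
  have sub: "(action A \<psi> \<circ>\<^sub>m action A \<phi>) z = Some y" if z: "action A (\<psi> \<circ>\<^sub>m \<phi>) z = Some y" for z y
  proof -
    obtain u v w where u: "z = u @- w" "y = v @- w" "(\<psi> \<circ>\<^sub>m \<phi>) u = Some v" "w \<in> streams A"
      using action_SomeE[OF comp z] by metis
    then obtain t where "\<phi> u = Some t" "\<psi> t = Some v" by (auto simp: map_comp_Some_iff)
    then show ?thesis using u action_shift[OF \<phi>] action_shift[OF \<psi>] by simp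
  qed
  have sup: "action A (\<psi> \<circ>\<^sub>m \<phi>) z \<noteq> None" if zy: "(action A \<psi> \<circ>\<^sub>m action A \<phi>) z = Some y" for z y
  proof -
    obtain x where x: "action A \<phi> z = Some x" "action A \<psi> x = Some y"
      using zy by (auto simp: map_comp_Some_iff)
    obtain a b w' where a: "x = a @- w'" "\<psi> a = Some b" "w' \<in> streams A"
      using action_SomeE[OF \<psi> x(2)] by metis
    obtain u v w where u: "z = u @- w" "x = v @- w" "\<phi> u = Some v" "w \<in> streams A" "length a \<le> length v"
      \<comment> \<open>The image \<open>v\<close> is taken at least as long as \<open>a\<close>,
        hence is an extension of it and lies in \<open>dom \<psi>\<close>.\<close>
      using action_SomeE[OF \<phi> x(1), where m = "length a"] by metis
    obtain r where r: "v = a @ r" "w' = r @- w"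
      using shift_eq_shiftD[of v w a w'] u a by auto
    then have "r \<in> lists A" using a(3) shift_streamsD by blast
    then have "(\<psi> \<circ>\<^sub>m \<phi>) u = Some (b @ r)"
      using right_ideal_hom_append[OF \<psi> a(2)] r u(3) by simp
    then show ?thesis using action_shift[OF comp] u by blast
  qed
  show ?thesis
  proof
    fix z
    show "action A (\<psi> \<circ>\<^sub>m \<phi>) z = (action A \<psi> \<circ>\<^sub>m action A \<phi>) z"
      using sub sup
      by (cases "action A (\<psi> \<circ>\<^sub>m \<phi>) z"; cases "(action A \<psi> \<circ>\<^sub>m action A \<phi>) z") force+
  qed
qed

lemma carrier_M_monoid:
  "carrier (M_monoid A B) = {\<phi>. right_ideal_hom A B \<phi> \<and> max_hom A B (action A \<phi>) = \<phi>}"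
  using max_extension_eq by (auto simp: M_monoid_def)

lemma mult_M_monoid:
  assumes "\<phi> \<in> carrier (M_monoid A B)" "\<psi> \<in> carrier (M_monoid A B)"
  shows "\<psi> \<otimes>\<^bsub>M_monoid A B\<^esub> \<phi> = max_hom A B (action A (\<psi> \<circ>\<^sub>m \<phi>))"
proof -
  have "right_ideal_hom A B (\<psi> \<circ>\<^sub>m \<phi>)"
    using assms right_ideal_hom_comp by (simp add: carrier_M_monoid)
  from max_extension_eq[OF this] show ?thesis by (simp add: M_monoid_def)
qed

lemma max_hom_in_carrier:
  "table_map id A B A B f \<Longrightarrow> max_hom A B f \<in> carrier (M_monoid A B)"
  by (simp add: carrier_M_monoid right_ideal_hom_max_hom action_max_hom)

lemma M_monoid_closed:
  assumes "\<phi> \<in> carrier (M_monoid A B)" "\<psi> \<in> carrier (M_monoid A B)"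
  shows "\<psi> \<otimes>\<^bsub>M_monoid A B\<^esub> \<phi> \<in> carrier (M_monoid A B)"
  unfolding mult_M_monoid[OF assms]
  using assms by (intro max_hom_in_carrier table_map_action right_ideal_hom_comp)
    (auto simp: carrier_M_monoid)

text \<open>On maximally extended homomorphisms \<open>action A\<close> and
  \<open>max_hom A B\<close> are inverse to each other. The maximal extension in the product
  disappears because it does not change the action.\<close>

lemma M_monoid_iso_table_monoid: "M_monoid A B \<cong> table_monoid A B"
proof -
  have "action A \<in> iso (M_monoid A B) (table_monoid A B)"
  proof (rule isoI)
    have "action A (\<psi> \<otimes>\<^bsub>M_monoid A B\<^esub> \<phi>) = action A \<psi> \<circ>\<^sub>m action A \<phi>"
      if "\<phi> \<in> carrier (M_monoid A B)" "\<psi> \<in> carrier (M_monoid A B)" for \<phi> \<psi>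
    proof -
      have hom: "right_ideal_hom A B \<phi>" "right_ideal_hom A B \<psi>"
        using that by (auto simp: carrier_M_monoid)
      show ?thesis
        unfolding mult_M_monoid[OF that]
        using action_max_hom[OF table_map_action[OF right_ideal_hom_comp[OF hom]]] action_comp[OF hom]
        by simp
    qed
    then show "action A \<in> hom (M_monoid A B) (table_monoid A B)"
      by (auto simp: hom_def table_monoid_def table_map_action carrier_M_monoid)
    show "bij_betw (action A) (carrier (M_monoid A B)) (carrier (table_monoid A B))"
      by (rule bij_betw_byWitness[where f' = "max_hom A B"])
        (auto simp: table_monoid_def action_max_hom max_hom_in_carrier,
         auto simp: carrier_M_monoid table_map_action)
  qed
  then show ?thesis by (rule is_isoI)
qed

lemma table_monoid_iso_M_monoid: "table_monoid A B \<cong> M_monoid A B"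
  using M_monoid_iso_table_monoid M_monoid_closed by (rule iso_sym_closed)

end

section \<open>Changing the alphabets\<close>

definition relabel ::
    "('a \<Rightarrow> 'b) \<Rightarrow> ('a \<Rightarrow> 'b) \<Rightarrow> 'a set \<Rightarrow> 'a set \<Rightarrow> ('a stream \<rightharpoonup> 'b stream)" where
  "relabel \<alpha> \<beta> A B z = (if z \<in> ends A B then Some (\<beta> (shd z) ## smap \<alpha> (stl z)) else None)"

lemma table_map_relabel:
  assumes "\<alpha> ` A \<subseteq> A'" "\<beta> ` B \<subseteq> B'"
  shows "table_map \<alpha> A B A' B' (relabel \<alpha> \<beta> A B)"
proof -
  have "\<exists>v\<in>words A' B'. \<forall>w\<in>streams A. relabel \<alpha> \<beta> A B (u @- w) = Some (v @- smap \<alpha> w)"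
    if u: "u \<in> words A B" for u
  proof -
    obtain b x where "u = b # x" "b \<in> B" "x \<in> lists A" using u by (auto simp: words_def)
    then show ?thesis
      using assms shift_in_ends[OF u]
      by (intro bexI[of _ "\<beta> b # map \<alpha> x"]) (auto simp: relabel_def words_def image_subset_iff)
  qed
  then show ?thesis by (auto simp: table_map_def relabel_def split: if_splits)
qed

lemma relabel_comp:
  assumes "\<And>a. a \<in> A \<Longrightarrow> \<alpha> a \<in> A' \<and> \<alpha>' (\<alpha> a) = a" "\<And>b. b \<in> B \<Longrightarrow> \<beta> b \<in> B' \<and> \<beta>' (\<beta> b) = b"
  shows "relabel \<alpha>' \<beta>' A' B' \<circ>\<^sub>m relabel \<alpha> \<beta> A B = Some |` ends A B"
proof
  fix z
  have "smap \<alpha> w \<in> streams A'" "smap \<alpha>' (smap \<alpha> w) = w" if "w \<in> streams A" for w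
    using that assms(1)
    by (auto simp: streams_iff_sset stream.set_map stream.map_comp intro!: stream.map_ident_strong)
  then show "(relabel \<alpha>' \<beta>' A' B' \<circ>\<^sub>m relabel \<alpha> \<beta> A B) z = (Some |` ends A B) z"
    using assms(2) by (auto simp: relabel_def map_comp_def restrict_map_def ends_def)
qed

text \<open>Makes the table monoid depend on the sizes of the alphabets only, so that initial
  segments of the naturals can replace them.\<close>

lemma table_monoid_relabel:
  assumes \<alpha>: "bij_betw \<alpha> A A'" and \<beta>: "bij_betw \<beta> B B'"
  shows "table_monoid A B \<cong> table_monoid A' B'"
proof -
  let ?\<alpha>' = "inv_into A \<alpha>" and ?\<beta>' = "inv_into B \<beta>"
  have fwd: "\<alpha> a \<in> A' \<and> ?\<alpha>' (\<alpha> a) = a" if "a \<in> A" for a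
    using that \<alpha> by (auto simp: bij_betw_inv_into_left bij_betw_apply)
  have bwd: "?\<alpha>' a \<in> A \<and> \<alpha> (?\<alpha>' a) = a" if "a \<in> A'" for a
    using that \<alpha> by (auto simp: bij_betw_inv_into_right bij_betw_apply[OF bij_betw_inv_into])
  have fwd': "\<beta> a \<in> B' \<and> ?\<beta>' (\<beta> a) = a" if "a \<in> B" for a
    using that \<beta> by (auto simp: bij_betw_inv_into_left bij_betw_apply)
  have bwd': "?\<beta>' a \<in> B \<and> \<beta> (?\<beta>' a) = a" if "a \<in> B'" for a
    using that \<beta> by (auto simp: bij_betw_inv_into_right bij_betw_apply[OF bij_betw_inv_into])
  show ?thesis
  proof (rule table_monoid_iso)
    show "table_map \<alpha> A B A' B' (relabel \<alpha> \<beta> A B)"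
      using fwd fwd' by (intro table_map_relabel) auto
    show "table_map ?\<alpha>' A' B' A B (relabel ?\<alpha>' ?\<beta>' A' B')"
      using bwd bwd' by (intro table_map_relabel) auto
    show "relabel ?\<alpha>' ?\<beta>' A' B' \<circ>\<^sub>m relabel \<alpha> \<beta> A B = Some |` ends A B"
      using fwd fwd' by (rule relabel_comp)
    show "relabel \<alpha> \<beta> A B \<circ>\<^sub>m relabel ?\<alpha>' ?\<beta>' A' B' = Some |` ends A' B'"
      using bwd bwd' by (rule relabel_comp)
  qed (use fwd bwd in auto)
qed

text \<open>The last letter \<open>r\<close> of \<open>{..<Suc r}\<close> is replaced by the \<open>k\<close> words \<open>r 0, \<dots>, r (k - 1)\<close>, which
  are encoded as the single letters \<open>r, \<dots>, r + k - 1\<close>.\<close>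
lemma table_monoid_expand:
  assumes "1 \<le> k"
  shows "table_monoid {..<k} {..<Suc r} \<cong> table_monoid {..<k} {..<r + k}"
proof -
  let ?A = "{..<k}" and ?B = "{..<Suc r}" and ?B' = "{..<r + k}"
  define \<theta> where "\<theta> z = (if z \<in> ends ?A ?B then
      Some (if shd z < r then z else (r + shd (stl z)) ## stl (stl z)) else None)" for z
  define \<theta>' where "\<theta>' z = (if z \<in> ends ?A ?B' then
      Some (if shd z < r then z else r ## (shd z - r) ## stl z) else None)" for z
  show ?thesis
  proof (rule table_monoid_iso)
    \<comment> \<open>Two letters are required: when the first is \<open>r\<close>, the second one
      is merged into it.\<close>
    have "\<exists>v\<in>words ?A ?B'. \<forall>w\<in>streams ?A. \<theta> (u @- w) = Some (v @- smap id w)"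
      if u: "u \<in> words ?A ?B" "2 \<le> length u" for u
    proof -
      obtain b a x where "u = b # a # x" "b < Suc r" "a < k" "x \<in> lists ?A"
        using u by (cases u; cases "tl u") (auto simp: words_def)
      then show ?thesis
        using assms shift_in_ends[OF u(1)]
        by (intro bexI[of _ "if b < r then u else (r + a) # x"])
          (auto simp: \<theta>_def words_def stream.map_id)
    qed
    then show "table_map id ?A ?B ?A ?B' \<theta>"
      unfolding table_map_def by (intro conjI exI[of _ 2]) (auto simp: \<theta>_def split: if_splits)
    \<comment> \<open>In this direction the first letter alone decides, and every word has
      one.\<close>
    have "\<exists>v\<in>words ?A ?B. \<forall>w\<in>streams ?A. \<theta>' (u @- w) = Some (v @- smap id w)"
      if u: "u \<in> words ?A ?B'" for u
    proof -
      obtain b x where "u = b # x" "b < r + k" "x \<in> lists ?A"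
        using u by (auto simp: words_def)
      then show ?thesis
        using assms shift_in_ends[OF u]
        by (intro bexI[of _ "if b < r then u else r # (b - r) # x"])
          (auto simp: \<theta>'_def words_def stream.map_id)
    qed
    then show "table_map id ?A ?B' ?A ?B \<theta>'"
      unfolding table_map_def by (intro conjI exI[of _ 0]) (auto simp: \<theta>'_def split: if_splits)
    show "\<theta>' \<circ>\<^sub>m \<theta> = Some |` ends ?A ?B"
    proof
      fix z show "(\<theta>' \<circ>\<^sub>m \<theta>) z = (Some |` ends ?A ?B) z"
        using assms by (cases z; cases "stl z")
          (auto simp: \<theta>_def \<theta>'_def ends_def map_comp_def restrict_map_def streams_Stream)
    qed
    show "\<theta> \<circ>\<^sub>m \<theta>' = Some |` ends ?A ?B'"
    proof
      fix z show "(\<theta> \<circ>\<^sub>m \<theta>') z = (Some |` ends ?A ?B') z"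
        using assms by (cases z)
          (auto simp: \<theta>_def \<theta>'_def ends_def map_comp_def restrict_map_def streams_Stream)
    qed
  qed auto
qed

section \<open>Alphabets of congruent sizes\<close>

lemma table_monoid_expand_iterated:
  fixes s k m :: nat
  assumes "1 \<le> s" "1 \<le> k"
  shows "table_monoid {..<k} {..<s} \<cong> table_monoid {..<k} {..<s + m * (k - 1)}"
proof (induct m)
  case 0
  show ?case by (simp add: iso_refl)
next
  case (Suc m)
  \<comment> \<open>The number \<open>r\<close> of unexpanded letters is one less than the current
    size; the subtraction is exact because \<open>s\<close> is positive. Each round trades one
    letter for \<open>k\<close>.\<close>
  have "Suc (s + m * (k - 1) - 1) = s + m * (k - 1)"
    "s + m * (k - 1) - 1 + k = s + Suc m * (k - 1)" using assms by auto
  with table_monoid_expand[OF assms(2), of "s + m * (k - 1) - 1"] Suc show ?case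
    by (metis iso_trans)
qed

lemma table_monoid_iso_nat:
  assumes "finite A" "finite B"
  shows "table_monoid A B \<cong> table_monoid {..<card A} {..<card B}"
proof -
  obtain \<alpha> \<beta> where "bij_betw \<alpha> A {..<card A}" "bij_betw \<beta> B {..<card B}"
    using ex_bij_betw_finite_nat[OF assms(1)] ex_bij_betw_finite_nat[OF assms(2)]
    by (auto simp: lessThan_atLeast0)
  then show ?thesis by (rule table_monoid_relabel)
qed

theorem proposition3p1:
  fixes A B :: "'a set" and A' B' :: "'b set" and k s t :: nat
  assumes "finite A" and "card A = k" and "finite B" and "card B = s"
    and "finite A'" and "card A' = k" and "finite B'" and "card B' = t"
    and "k \<ge> 2" and "s \<ge> 1" and "t \<ge> 1"
    and "[s = t] (mod (k - 1))"
  shows "M_monoid A B \<cong> M_monoid A' B'"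
proof -
  interpret M: alphabets A B using assms by unfold_locales auto
  interpret M': alphabets A' B' using assms by unfold_locales auto
  have expand: "table_monoid {..<k} {..<m} \<cong> table_monoid {..<k} {..<n}"
    if mn: "1 \<le> m" "m \<le> n" "[m = n] (mod (k - 1))" for m n
  proof -
    obtain q where "n = m + q * (k - 1)"
      using mn(2,3) by (metis cong_le_nat cong_sym add.commute)
    then show ?thesis using table_monoid_expand_iterated[of m k q] mn(1) assms by simp
  qed
  have "table_monoid {..<k} {..<s} \<cong> table_monoid {..<k} {..<t}"
  proof (cases "s \<le> t")
    case True
    then show ?thesis using expand assms by blast
  next
    \<comment> \<open>Expansion only enlarges the alphabet, so it starts from \<open>t\<close> and
      the isomorphism is inverted.\<close>
    case False
    then have "t \<le> s" by simp
    then have "table_monoid {..<k} {..<t} \<cong> table_monoid {..<k} {..<s}"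
      by (rule expand[OF assms(11) _ cong_sym[OF assms(12)]])
    then show ?thesis using table_monoid_closed by (rule iso_sym_closed)
  qed
  moreover have "table_monoid A B \<cong> table_monoid {..<k} {..<s}"
    using table_monoid_iso_nat[OF assms(1,3)] assms(2,4) by simp
  moreover have "table_monoid {..<k} {..<t} \<cong> table_monoid A' B'"
    using iso_sym_closed[OF table_monoid_iso_nat[OF assms(5,7)] table_monoid_closed] assms(6,8)
    by simp
  ultimately show ?thesis
    using M.M_monoid_iso_table_monoid M'.table_monoid_iso_M_monoid by (meson iso_trans)
qed

end
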